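(* Let $a,b\in\mathbb{R}$ with $a\neq0$, $b\geq0$, and let $(L,H,G)$ be the 4-dimensional almost hypercomplex manifold with Hermitian-Norden metrics constructed (as in the context) on a simply connected 4-dimensional real Lie group $L$ whose Lie algebra is $g_{4,6}$ with parameters $a,b$. Then, for each $a\neq0$, $b\geq0$, $(L,H,G)$ belongs to the class $$(\mathcal{W}_2\oplus\mathcal{W}_4)(J_1)\cap(\mathcal{W}_1\oplus\mathcal{W}_2\oplus\mathcal{W}_3)(J_2)\cap(\mathcal{W}_1\oplus\mathcal{W}_2)(J_3).$$ Moreover, $(L,H,G)$ does not belong to any of the classes: $\mathcal{W}_2$, $\mathcal{W}_4$ for $J_1$; $\mathcal{W}_1$, $\mathcal{W}_2$, $\mathcal{W}_3$, $\mathcal{W}_1\oplus\mathcal{W}_2$, $\mathcal{W}_1\oplus\mathcal{W}_3$, $\mathcal{W}_2\oplus\mathcal{W}_3$ for $J_2$; $\mathcal{W}_1$, $\mathcal{W}_2$ for $J_3$.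
   Context: Lie algebra. $g_{4,6}$ is the real Lie algebra with basis $\{e_1,e_2,e_3,e_4\}$ whose only non-zero brackets (up to antisymmetry) are $[e_1,e_4]=a e_1$, $[e_2,e_4]=b e_2-e_3$, $[e_3,e_4]=e_2+b e_3$, with $a\neq0$, $b\geq0$. The $e_i$ are regarded as left-invariant vector fields on $L$. Structure. Left-invariant almost complex structures $J_1,J_2,J_3$ are defined by $J_1e_1=e_2$, $J_1e_2=-e_1$, $J_1e_3=-e_4$, $J_1e_4=e_3$; $J_2e_1=e_3$, $J_2e_2=e_4$, $J_2e_3=-e_1$, $J_2e_4=-e_2$; $J_3e_1=-e_4$, $J_3e_2=e_3$, $J_3e_3=-e_2$, $J_3e_4=e_1$; and $H=(J_1,J_2,J_3)$. The left-invariant neutral metric $g$ is $g(x,y)=x^1y^1+x^2y^2-x^3y^3-x^4y^4$ for $x=\sum_i x^ie_i$, $y=\sum_i y^ie_i$. Put $\varepsilon_1=1$, $\varepsilon_2=\varepsilon_3=-1$; then $g(x,y)=\varepsilon_\alpha g(J_\alpha x,J_\alpha y)$ for $\alpha=1,2,3$. Set $g_\alpha(x,y)=g(J_\alpha x,y)$ and $G=(g,g_1,g_2,g_3)$. Fundamental tensors. Let $\nabla$ be the Levi-Civita connection of $g$, $F_\alpha(x,y,z)=g((\nabla_xJ_\alpha)y,z)$, and let $\theta_\alpha(z)=g^{kl}F_\alpha(e_k,e_l,z)$ be the corresponding Lee form. One has $F_\alpha(x,y,z)=-\varepsilon_\alpha F_\alpha(x,z,y)=-\varepsilon_\alpha F_\alpha(x,J_\alpha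 y,J_\alpha z)$. Below, $\mathfrak{S}_{x,y,z}$ denotes the cyclic sum over $x,y,z$. Classes in dimension 4. With respect to $J_1$: $\mathcal{W}_2(J_1)$: $\mathfrak{S}_{x,y,z}F_1(x,y,z)=0$; $\mathcal{W}_4(J_1)$: $F_1(x,y,z)=\frac12\{g(x,y)\theta_1(z)-g(x,J_1y)\theta_1(J_1z)-g(x,z)\theta_1(y)+g(x,J_1z)\theta_1(J_1y)\}$. With respect to $J_\alpha$, $\alpha=2,3$: $\mathcal{W}_1(J_\alpha)$: $F_\alpha(x,y,z)=\frac14\{g(x,y)\theta_\alpha(z)+g(x,J_\alpha y)\theta_\alpha(J_\alpha z)+g(x,z)\theta_\alpha(y)+g(x,J_\alpha z)\theta_\alpha(J_\alpha y)\}$; $\mathcal{W}_2(J_\alpha)$: $\mathfrak{S}_{x,y,z}F_\alpha(x,y,J_\alpha z)=0$ and $\theta_\alpha=0$; $\mathcal{W}_3(J_\alpha)$: $\mathfrak{S}_{x,y,z}F_\alpha(x,y,z)=0$. As is standard for the Gray–Hervella and Ganchev–Borisov classifications, each condition defines a linear subspace of the space of $(0,3)$-tensors $F$ satisfying $F(x,y,z)=-\varepsilon_\alpha F(x,z,y)=-\varepsilon_\alpha F(x,J_\alpha y,J_\alpha z)$ (with $\theta$ the trace of $F$ defined by $\theta(z)=g^{kl}F(e_k,e_l,z)$); a manifold belongs to a basic class w.r.t. $J_\alpha$ if $F_\alpha$ lies in this subspace at each point, and it belongs to a direct sum of basic classes if $F_\alpha$ lies in the sum of the corresponding subspaces at each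 point. *)

theory Defs
  imports "HOL-Analysis.Analysis" "HOL-Library.Function_Algebras" "HOL-Library.Set_Algebras"
begin

section \<open>Smooth manifolds and Lie groups\<close>

text \<open>For open \<open>S\<close>, \<open>C_diff k S f\<close> says that all partial derivatives of \<open>f\<close> of order at most \<open>k\<close>
  exist and are continuous on \<open>S\<close>.\<close>

primrec C_diff :: "nat \<Rightarrow> 'a::euclidean_space set \<Rightarrow> ('a \<Rightarrow> 'b::real_normed_vector) \<Rightarrow> bool" where
  "C_diff 0 S f \<longleftrightarrow> continuous_on S f"
| "C_diff (Suc k) S f \<longleftrightarrow> (\<forall>x\<in>S. f differentiable (at x)) \<and>
     (\<forall>v. C_diff k S (\<lambda>x. frechet_derivative f (at x) v))"

definition smooth_on :: "'a::euclidean_space set \<Rightarrow> ('a \<Rightarrow> 'b::real_normed_vector) \<Rightarrow> bool" where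
  "smooth_on S f \<longleftrightarrow> (\<forall>k. C_diff k S f)"

type_synonym ('m, 'e) atlas = "('m set \<times> ('m \<Rightarrow> 'e)) set"

definition chart :: "'m::topological_space set \<times> ('m \<Rightarrow> 'e::euclidean_space) \<Rightarrow> bool" where
  "chart c \<longleftrightarrow> (case c of (U, \<phi>) \<Rightarrow>
     open U \<and> inj_on \<phi> U \<and> open (\<phi> ` U) \<and> homeomorphism U (\<phi> ` U) \<phi> (inv_into U \<phi>))"

definition smooth_atlas :: "('m::topological_space, 'e::euclidean_space) atlas \<Rightarrow> bool" where
  "smooth_atlas A \<longleftrightarrow> (\<forall>c\<in>A. chart c) \<and> (\<Union>(U, \<phi>)\<in>A. U) = UNIV \<and>
     (\<forall>(U, \<phi>)\<in>A. \<forall>(V, \<psi>)\<in>A. smooth_on (\<phi> ` (U \<inter> V)) (\<psi> \<circ> inv_into U \<phi>))"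

definition smooth_map ::
  "('m::topological_space, 'e::euclidean_space) atlas \<Rightarrow>
   ('n::topological_space, 'f::euclidean_space) atlas \<Rightarrow> ('m \<Rightarrow> 'n) \<Rightarrow> bool" where
  "smooth_map A B f \<longleftrightarrow> continuous_on UNIV f \<and>
     (\<forall>(U, \<phi>)\<in>A. \<forall>(V, \<psi>)\<in>B. smooth_on (\<phi> ` (U \<inter> f -` V)) (\<psi> \<circ> f \<circ> inv_into U \<phi>))"

definition prod_atlas :: "('m, 'e) atlas \<Rightarrow> ('n, 'f) atlas \<Rightarrow> ('m \<times> 'n, 'e \<times> 'f) atlas" where
  "prod_atlas A B = {(U \<times> V, map_prod \<phi> \<psi>) | U \<phi> V \<psi>. (U, \<phi>) \<in> A \<and> (V, \<psi>) \<in> B}"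

text \<open>The group operation is written additively, as in the class \<open>topological_group_add\<close>; it is
  not assumed to be commutative.\<close>

definition lie_group ::
  "('l::{topological_group_add, t2_space, second_countable_topology}, 'e::euclidean_space) atlas \<Rightarrow> bool"
  where "lie_group A \<longleftrightarrow> smooth_atlas A \<and>
     smooth_map (prod_atlas A A) A (\<lambda>(x, y). x + y) \<and> smooth_map A A uminus"

section \<open>Vector fields\<close>

type_synonym 'm vfield = "('m \<Rightarrow> real) \<Rightarrow> ('m \<Rightarrow> real)"

definition smooth_fun :: "('m::topological_space, 'e::euclidean_space) atlas \<Rightarrow> ('m \<Rightarrow> real) set" where
  "smooth_fun A = {f. smooth_map A {(UNIV, id :: real \<Rightarrow> real)} f}"

text \<open>Vector fields are the derivations of the algebra of smooth functions, extended by zero to all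
  other functions so that equality of vector fields is equality of HOL functions. Sums, differences
  and products are pointwise.\<close>

definition vfields :: "('m::topological_space, 'e::euclidean_space) atlas \<Rightarrow> 'm vfield set" where
  "vfields A = {X.
     (\<forall>f\<in>smooth_fun A. X f \<in> smooth_fun A) \<and>
     (\<forall>f. f \<notin> smooth_fun A \<longrightarrow> X f = 0) \<and>
     (\<forall>f\<in>smooth_fun A. \<forall>h\<in>smooth_fun A. X (f + h) = X f + X h) \<and>
     (\<forall>f\<in>smooth_fun A. \<forall>c::real. X ((\<lambda>_. c) * f) = (\<lambda>_. c) * X f) \<and>
     (\<forall>f\<in>smooth_fun A. \<forall>h\<in>smooth_fun A. X (f * h) = X f * h + f * X h)}"

definition fscale :: "('m \<Rightarrow> real) \<Rightarrow> 'm vfield \<Rightarrow> 'm vfield" where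
  "fscale f X = (\<lambda>h. f * X h)"

definition lie_bracket :: "'m vfield \<Rightarrow> 'm vfield \<Rightarrow> 'm vfield" where
  "lie_bracket X Y = (\<lambda>f. X (Y f) - Y (X f))"

definition left_invariant_fields ::
  "('l::{topological_group_add, t2_space, second_countable_topology}, 'e::euclidean_space) atlas \<Rightarrow> 'l vfield set"
  where "left_invariant_fields A = {X \<in> vfields A.
     \<forall>a. \<forall>f\<in>smooth_fun A. X (f \<circ> (\<lambda>x. a + x)) = X f \<circ> (\<lambda>x. a + x)}"

definition comb :: "('n::finite \<Rightarrow> 'm vfield) \<Rightarrow> real^'n \<Rightarrow> 'm vfield" where
  "comb e x = (\<Sum>i\<in>UNIV. fscale (\<lambda>_. x $ i) (e i))"

definition lie_algebra_basis ::
  "('l::{topological_group_add, t2_space, second_countable_topology}, 'e::euclidean_space) atlas \<Rightarrow>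
   ('n::finite \<Rightarrow> 'l vfield) \<Rightarrow> bool"
  where "lie_algebra_basis A e \<longleftrightarrow> bij_betw (comb e) UNIV (left_invariant_fields A)"

section \<open>Metrics, connections, endomorphism fields\<close>

text \<open>Nondegeneracy is required at each point: a vector field \<open>X\<close> vanishes at \<open>p\<close> iff
  \<open>X f p = 0\<close> for all smooth \<open>f\<close>.\<close>

definition pseudo_riemannian_metric ::
  "('m::topological_space, 'e::euclidean_space) atlas \<Rightarrow> ('m vfield \<Rightarrow> 'm vfield \<Rightarrow> 'm \<Rightarrow> real) \<Rightarrow> bool"
  where "pseudo_riemannian_metric A g \<longleftrightarrow>
     (\<forall>X\<in>vfields A. \<forall>Y\<in>vfields A. g X Y \<in> smooth_fun A \<and> g X Y = g Y X) \<and>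
     (\<forall>X\<in>vfields A. \<forall>Y\<in>vfields A. \<forall>Z\<in>vfields A. g (X + Y) Z = g X Z + g Y Z) \<and>
     (\<forall>f\<in>smooth_fun A. \<forall>X\<in>vfields A. \<forall>Y\<in>vfields A. g (fscale f X) Y = f * g X Y) \<and>
     (\<forall>X\<in>vfields A. \<forall>p. (\<forall>Y\<in>vfields A. g X Y p = 0) \<longrightarrow> (\<forall>f\<in>smooth_fun A. X f p = 0))"

definition affine_connection ::
  "('m::topological_space, 'e::euclidean_space) atlas \<Rightarrow> ('m vfield \<Rightarrow> 'm vfield \<Rightarrow> 'm vfield) \<Rightarrow> bool"
  where "affine_connection A nabla \<longleftrightarrow>
     (\<forall>X\<in>vfields A. \<forall>Y\<in>vfields A. nabla X Y \<in> vfields A) \<and>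
     (\<forall>X\<in>vfields A. \<forall>Y\<in>vfields A. \<forall>Z\<in>vfields A.
        nabla (X + Y) Z = nabla X Z + nabla Y Z \<and> nabla Z (X + Y) = nabla Z X + nabla Z Y) \<and>
     (\<forall>f\<in>smooth_fun A. \<forall>X\<in>vfields A. \<forall>Y\<in>vfields A.
        nabla (fscale f X) Y = fscale f (nabla X Y) \<and>
        nabla X (fscale f Y) = fscale (X f) Y + fscale f (nabla X Y))"

definition levi_civita ::
  "('m::topological_space, 'e::euclidean_space) atlas \<Rightarrow> ('m vfield \<Rightarrow> 'm vfield \<Rightarrow> 'm \<Rightarrow> real) \<Rightarrow>
   ('m vfield \<Rightarrow> 'm vfield \<Rightarrow> 'm vfield) \<Rightarrow> bool"
  where "levi_civita A g nabla \<longleftrightarrow> affine_connection A nabla \<and>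
     (\<forall>X\<in>vfields A. \<forall>Y\<in>vfields A. nabla X Y - nabla Y X = lie_bracket X Y) \<and>
     (\<forall>X\<in>vfields A. \<forall>Y\<in>vfields A. \<forall>Z\<in>vfields A. X (g Y Z) = g (nabla X Y) Z + g Y (nabla X Z))"

definition endomorphism_field ::
  "('m::topological_space, 'e::euclidean_space) atlas \<Rightarrow> ('m vfield \<Rightarrow> 'm vfield) \<Rightarrow> bool"
  where "endomorphism_field A J \<longleftrightarrow>
     (\<forall>X\<in>vfields A. J X \<in> vfields A) \<and>
     (\<forall>X\<in>vfields A. \<forall>Y\<in>vfields A. J (X + Y) = J X + J Y) \<and>
     (\<forall>f\<in>smooth_fun A. \<forall>X\<in>vfields A. J (fscale f X) = fscale f (J X))"

text \<open>The index type \<open>3\<close> consists of \<open>1\<close>, \<open>2\<close>, \<open>3 = 0\<close>, with addition modulo 3, so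
  \<open>(\<alpha>, \<alpha> + 1, \<alpha> + 2)\<close> is a cyclic permutation of \<open>(1, 2, 3)\<close>.\<close>

definition eps :: "3 \<Rightarrow> real" where
  "eps \<alpha> = (if \<alpha> = 1 then 1 else - 1)"

definition almost_hypercomplex_HN ::
  "('m::topological_space, 'e::euclidean_space) atlas \<Rightarrow> (3 \<Rightarrow> 'm vfield \<Rightarrow> 'm vfield) \<Rightarrow>
   ('m vfield \<Rightarrow> 'm vfield \<Rightarrow> 'm \<Rightarrow> real) \<Rightarrow> bool"
  where "almost_hypercomplex_HN A J g \<longleftrightarrow>
     pseudo_riemannian_metric A g \<and> (\<forall>\<alpha>. endomorphism_field A (J \<alpha>)) \<and>
     (\<forall>\<alpha>. \<forall>X\<in>vfields A. J \<alpha> (J \<alpha> X) = - X \<and>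
        J \<alpha> X = J (\<alpha> + 1) (J (\<alpha> + 2) X) \<and> J \<alpha> X = - J (\<alpha> + 2) (J (\<alpha> + 1) X)) \<and>
     (\<forall>\<alpha>. \<forall>X\<in>vfields A. \<forall>Y\<in>vfields A. g X Y = (\<lambda>_. eps \<alpha>) * g (J \<alpha> X) (J \<alpha> Y))"

definition fundamental_tensor ::
  "('m vfield \<Rightarrow> 'm vfield \<Rightarrow> 'm \<Rightarrow> real) \<Rightarrow> ('m vfield \<Rightarrow> 'm vfield \<Rightarrow> 'm vfield) \<Rightarrow>
   ('m vfield \<Rightarrow> 'm vfield) \<Rightarrow> 'm vfield \<Rightarrow> 'm vfield \<Rightarrow> 'm vfield \<Rightarrow> 'm \<Rightarrow> real"
  where "fundamental_tensor g nabla J X Y Z = g (nabla X (J Y) - J (nabla X Y)) Z"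

section \<open>The structure and the basic classes in the frame\<close>

text \<open>A left-invariant frame \<open>e\<close> identifies each tangent space with \<open>real^4\<close>, the vector \<open>x\<close>
  corresponding to the value at the point of the left-invariant field \<open>comb e x\<close>.\<close>

type_synonym tensor3 = "real^4 \<Rightarrow> real^4 \<Rightarrow> real^4 \<Rightarrow> real"

definition tensor_at ::
  "(4 \<Rightarrow> 'm vfield) \<Rightarrow> ('m vfield \<Rightarrow> 'm vfield \<Rightarrow> 'm vfield \<Rightarrow> 'm \<Rightarrow> real) \<Rightarrow> 'm \<Rightarrow> tensor3"
  where "tensor_at e F p = (\<lambda>x y z. F (comb e x) (comb e y) (comb e z) p)"

definition neutral_form :: "real^4 \<Rightarrow> real^4 \<Rightarrow> real" where
  "neutral_form x y = x$1 * y$1 + x$2 * y$2 - x$3 * y$3 - x$4 * y$4"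

abbreviation bvec :: "4 \<Rightarrow> real^4" where
  "bvec i \<equiv> axis i 1"

definition Jop :: "3 \<Rightarrow> real^4 \<Rightarrow> real^4" where
  "Jop \<alpha> x =
     (if \<alpha> = 1 then x$1 *\<^sub>R bvec 2 - x$2 *\<^sub>R bvec 1 - x$3 *\<^sub>R bvec 4 + x$4 *\<^sub>R bvec 3
      else if \<alpha> = 2 then x$1 *\<^sub>R bvec 3 + x$2 *\<^sub>R bvec 4 - x$3 *\<^sub>R bvec 1 - x$4 *\<^sub>R bvec 2
      else - (x$1 *\<^sub>R bvec 4) + x$2 *\<^sub>R bvec 3 - x$3 *\<^sub>R bvec 2 + x$4 *\<^sub>R bvec 1)"

definition lee_form :: "tensor3 \<Rightarrow> real^4 \<Rightarrow> real" where
  "lee_form F z = (\<Sum>k\<in>UNIV. \<Sum>l\<in>UNIV.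
     matrix_inv (\<chi> i j. neutral_form (bvec i) (bvec j)) $ k $ l * F (bvec k) (bvec l) z)"

definition tensor_space :: "3 \<Rightarrow> tensor3 set" where
  "tensor_space \<alpha> = {F.
     (\<forall>y z. linear (\<lambda>x. F x y z)) \<and> (\<forall>x z. linear (\<lambda>y. F x y z)) \<and> (\<forall>x y. linear (\<lambda>z. F x y z)) \<and>
     (\<forall>x y z. F x y z = - eps \<alpha> * F x z y \<and> F x y z = - eps \<alpha> * F x (Jop \<alpha> y) (Jop \<alpha> z))}"

text \<open>\<open>HW2\<close> and \<open>HW4\<close> are the classes of the Gray-Hervella classification, for \<open>J 1\<close>;
  \<open>NW1\<close>, \<open>NW2\<close> and \<open>NW3\<close> those of the Ganchev-Borisov classification, for \<open>J 2\<close> and \<open>J 3\<close>.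
  The sum of subspaces is \<open>+\<close> on sets.\<close>

definition HW2 :: "tensor3 set" where
  "HW2 = {F \<in> tensor_space 1. \<forall>x y z. F x y z + F y z x + F z x y = 0}"

definition HW4 :: "tensor3 set" where
  "HW4 = {F \<in> tensor_space 1. \<forall>x y z. F x y z = 1/2 *
     (neutral_form x y * lee_form F z - neutral_form x (Jop 1 y) * lee_form F (Jop 1 z)
      - neutral_form x z * lee_form F y + neutral_form x (Jop 1 z) * lee_form F (Jop 1 y))}"

definition NW1 :: "3 \<Rightarrow> tensor3 set" where
  "NW1 \<alpha> = {F \<in> tensor_space \<alpha>. \<forall>x y z. F x y z = 1/4 *
     (neutral_form x y * lee_form F z + neutral_form x (Jop \<alpha> y) * lee_form F (Jop \<alpha> z)
      + neutral_form x z * lee_form F y + neutral_form x (Jop \<alpha> z) * lee_form F (Jop \<alpha> y))}"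

definition NW2 :: "3 \<Rightarrow> tensor3 set" where
  "NW2 \<alpha> = {F \<in> tensor_space \<alpha>.
     (\<forall>x y z. F x y (Jop \<alpha> z) + F y z (Jop \<alpha> x) + F z x (Jop \<alpha> y) = 0) \<and> (\<forall>z. lee_form F z = 0)}"

definition NW3 :: "3 \<Rightarrow> tensor3 set" where
  "NW3 \<alpha> = {F \<in> tensor_space \<alpha>. \<forall>x y z. F x y z + F y z x + F z x y = 0}"

definition belongs :: "('m \<Rightarrow> tensor3) \<Rightarrow> tensor3 set \<Rightarrow> bool" where
  "belongs F W \<longleftrightarrow> (\<forall>p. F p \<in> W)"

end

theory Submission
  imports Defs
begin

text \<open>
  The metric and the almost complex structures have constant coefficients in the left-invariant
  frame, so every term of the Koszul formula that differentiates a function vanishes. The Levi-Civita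
  connection, and with it each \<open>F\<^sub>\<alpha>\<close>, is therefore a single tensor on \<open>real^4\<close>, given by the bracket
  (\<open>levi_civita_koszul\<close>, \<open>fundamental_tensor_in_frame\<close>). What remains is linear algebra of tensors on
  one tangent space.

  For each \<open>J\<^sub>\<alpha>\<close> the basic classes add up to the whole tensor space (for \<open>J\<^sub>1\<close> this uses dimension 4),
  and two tests suffice to locate a tensor in it:

  \<^item> For \<open>J\<^sub>1\<close>, a tensor is in \<open>\<W>\<^sub>2\<close> exactly if its Lee form vanishes (\<open>HW2_iff_lee_form_0\<close>). Subtracting
    the \<open>\<W>\<^sub>4\<close> tensor with the same Lee form thus leaves a \<open>\<W>\<^sub>2\<close> tensor.

  \<^item> For \<open>J\<^sub>2\<close> and \<open>J\<^sub>3\<close>, let \<open>T(x,y,z)\<close> be the cyclic sum of \<open>F(x,y,Jz)\<close>. It is a 3-form which vanishes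
    on \<open>\<W>\<^sub>1 \<oplus> \<W>\<^sub>2\<close>, and from \<open>T\<close> one recovers the \<open>\<W>\<^sub>3\<close> component of \<open>F\<close> (\<open>twisted_cyclic_NW3_part\<close>).
    The Lee form vanishes on \<open>\<W>\<^sub>2 \<oplus> \<W>\<^sub>3\<close> and determines the \<open>\<W>\<^sub>1\<close> component. Hence every tensor
    decomposes (\<open>norden_decomposition\<close>), and \<open>\<W>\<^sub>1 \<oplus> \<W>\<^sub>2\<close> is the kernel of \<open>F \<mapsto> T\<close>.

  For \<open>g\<^sub>4\<^sub>,\<^sub>6\<close> it turns out that \<open>T = 0\<close> for \<open>F\<^sub>3\<close>, which gives the membership for \<open>J\<^sub>3\<close>. Each
  non-membership is witnessed by one component of a Lee form, of \<open>T\<close>, or of the difference between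
  \<open>F\<^sub>\<alpha>\<close> and the tensor built from its Lee form. These components can be chosen to be nonzero constants:
  they come from the entries \<open>\<plusminus>1\<close> in the rotation part of the action of \<open>e\<^sub>4\<close> on the plane spanned by
  \<open>e\<^sub>2\<close> and \<open>e\<^sub>3\<close>.
\<close>

section \<open>The pointwise structure\<close>

lemma Jop_nth [simp]:
  "Jop 1 x $ 1 = - x $ 2" "Jop 1 x $ 2 = x $ 1" "Jop 1 x $ 3 = x $ 4" "Jop 1 x $ 4 = - x $ 3"
  "Jop 2 x $ 1 = - x $ 3" "Jop 2 x $ 2 = - x $ 4" "Jop 2 x $ 3 = x $ 1" "Jop 2 x $ 4 = x $ 2"
  "Jop 3 x $ 1 = x $ 4" "Jop 3 x $ 2 = - x $ 3" "Jop 3 x $ 3 = x $ 2" "Jop 3 x $ 4 = - x $ 1"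
  by (simp_all add: Jop_def axis_def)

lemma eps_simps [simp]: "eps 1 = 1" "eps 2 = - 1" "eps 3 = - 1"
  by (simp_all add: eps_def)

lemma eps_mult_self: "eps \<alpha> * eps \<alpha> = 1"
  by (simp add: eps_def)

lemma Jop_Jop [simp]: "Jop \<alpha> (Jop \<alpha> x) = - x"
  using exhaust_3 [of \<alpha>] by (auto simp: vec_eq_iff forall_4)

lemma linear_Jop: "linear (Jop \<alpha>)"
  using exhaust_3 [of \<alpha>] by (auto intro!: linearI simp: vec_eq_iff forall_4)

lemmas Jop_linear_simps = linear_add [OF linear_Jop] linear_diff [OF linear_Jop]
  linear_neg [OF linear_Jop] linear_scale [OF linear_Jop]

lemma neutral_form_sym: "neutral_form x y = neutral_form y x"
  by (simp add: neutral_form_def)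

lemma bilinear_neutral_form: "bilinear neutral_form"
  by (auto simp: bilinear_def neutral_form_def algebra_simps intro!: linearI)

lemma bvec_nth: "bvec i $ j = (if i = j then 1 else 0)"
  by (simp add: axis_def)

lemma lee_form_eq:
  "lee_form F z = F (bvec 1) (bvec 1) z + F (bvec 2) (bvec 2) z
     - F (bvec 3) (bvec 3) z - F (bvec 4) (bvec 4) z"
proof -
  \<comment> \<open>The Gram matrix is diagonal with entries \<open>\<plusminus>1\<close>, so it is its own inverse.\<close>
  define D :: "real^4^4" where "D = (\<chi> i j. neutral_form (bvec i) (bvec j))"
  have DD: "D ** D = mat 1"
    by (simp add: vec_eq_iff forall_4 matrix_matrix_mult_def sum_4 D_def neutral_form_def bvec_nth mat_def)
  have "matrix_inv D ** D = mat 1"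
    using someI [of "\<lambda>B. D ** B = mat 1 \<and> B ** D = mat 1", OF conjI, OF DD DD]
    by (simp add: matrix_inv_def)
  then have "matrix_inv D = D"
    by (metis DD matrix_mul_assoc matrix_mul_lid matrix_mul_rid)
  then show ?thesis
    unfolding lee_form_def D_def [symmetric]
    by (simp add: sum_4 D_def neutral_form_def bvec_nth)
qed

lemma lee_form_add: "lee_form (F + G) z = lee_form F z + lee_form G z"
  by (simp add: lee_form_eq)

lemma lee_form_diff: "lee_form (F - G) z = lee_form F z - lee_form G z"
  by (simp add: lee_form_eq)

lemma linear_coordinates:
  fixes \<theta> :: "real^4 \<Rightarrow> real"
  assumes "linear \<theta>"
  shows "\<theta> x = x$1 * \<theta> (bvec 1) + x$2 * \<theta> (bvec 2) + x$3 * \<theta> (bvec 3) + x$4 * \<theta> (bvec 4)"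
proof -
  have "x$1 *\<^sub>R bvec 1 + x$2 *\<^sub>R bvec 2 + x$3 *\<^sub>R bvec 3 + x$4 *\<^sub>R bvec 4 = x"
    by (simp add: vec_eq_iff forall_4 bvec_nth)
  then show ?thesis
    by (metis linear_add [OF assms] linear_scale [OF assms] real_scaleR_def)
qed

definition trilinear :: "tensor3 \<Rightarrow> bool" where
  "trilinear F \<longleftrightarrow> (\<forall>y z. linear (\<lambda>x. F x y z)) \<and> (\<forall>x z. linear (\<lambda>y. F x y z)) \<and>
     (\<forall>x y. linear (\<lambda>z. F x y z))"

lemma trilinearD:
  assumes "trilinear F"
  shows "F (x + x') y z = F x y z + F x' y z" "F x (y + y') z = F x y z + F x y' z"
    "F x y (z + z') = F x y z + F x y z'"
    "F (- x) y z = - F x y z" "F x (- y) z = - F x y z" "F x y (- z) = - F x y z"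
    "F (c *\<^sub>R x) y z = c * F x y z" "F x (c *\<^sub>R y) z = c * F x y z"
    "F x y (c *\<^sub>R z) = c * F x y z"
proof -
  have l: "linear (\<lambda>x. F x y z)" "linear (\<lambda>y. F x y z)" "linear (\<lambda>z. F x y z)" for x y z
    using assms by (auto simp: trilinear_def)
  show "F (x + x') y z = F x y z + F x' y z" "F x (y + y') z = F x y z + F x y' z"
    "F x y (z + z') = F x y z + F x y z'"
    using linear_add [OF l(1)] linear_add [OF l(2)] linear_add [OF l(3)] by simp_all
  show "F (- x) y z = - F x y z" "F x (- y) z = - F x y z" "F x y (- z) = - F x y z"
    using linear_neg [OF l(1)] linear_neg [OF l(2)] linear_neg [OF l(3)] by simp_all
  show "F (c *\<^sub>R x) y z = c * F x y z" "F x (c *\<^sub>R y) z = c * F x y z"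
    "F x y (c *\<^sub>R z) = c * F x y z"
    using linear_scale [OF l(1)] linear_scale [OF l(2)] linear_scale [OF l(3)] by simp_all
qed

lemma trilinearI:
  assumes "\<And>x x' y z. F (x + x') y z = F x y z + F x' y z"
    "\<And>x y y' z. F x (y + y') z = F x y z + F x y' z"
    "\<And>x y z z'. F x y (z + z') = F x y z + F x y z'"
    "\<And>c x y z. F (c *\<^sub>R x) y z = c * F x y z" "\<And>c x y z. F x (c *\<^sub>R y) z = c * F x y z"
    "\<And>c x y z. F x y (c *\<^sub>R z) = c * F x y z"
  shows "trilinear F"
  unfolding trilinear_def by (simp add: assms linearI)

lemma trilinear_diff:
  assumes "trilinear F" "trilinear G"
  shows "trilinear (F - G)"
  by (rule trilinearI) (simp_all add: assms [THEN trilinearD(1)] assms [THEN trilinearD(2)]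
      assms [THEN trilinearD(3)] assms [THEN trilinearD(7)] assms [THEN trilinearD(8)]
      assms [THEN trilinearD(9)] algebra_simps)

lemma trilinear_eq_0:
  assumes "trilinear F" "\<And>i j k. F (bvec i) (bvec j) (bvec k) = 0"
  shows "F x y z = 0"
proof -
  have l: "linear (\<lambda>x. F x y z)" "linear (\<lambda>y. F x y z)" "linear (\<lambda>z. F x y z)" for x y z
    using assms(1) by (auto simp: trilinear_def)
  have 1: "F (bvec i) (bvec j) z = 0" for i j z
    using linear_coordinates [OF l(3), of "bvec i" "bvec j" z] by (simp add: assms(2))
  have 2: "F (bvec i) y z = 0" for i y z
    using linear_coordinates [OF l(2), of "bvec i" y z] by (simp add: 1)
  show ?thesis
    using linear_coordinates [OF l(1), of x y z] by (simp add: 2)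
qed

lemma tensor_space_iff:
  "F \<in> tensor_space \<alpha> \<longleftrightarrow> trilinear F \<and> (\<forall>x y z. F x y z = - eps \<alpha> * F x z y) \<and>
     (\<forall>x y z. F x y z = - eps \<alpha> * F x (Jop \<alpha> y) (Jop \<alpha> z))"
  unfolding tensor_space_def trilinear_def mem_Collect_eq by blast

lemma tensor_spaceD:
  assumes "F \<in> tensor_space \<alpha>"
  shows "trilinear F" "F x y z = - eps \<alpha> * F x z y"
    "F x y z = - eps \<alpha> * F x (Jop \<alpha> y) (Jop \<alpha> z)"
  using assms unfolding tensor_space_iff by blast+

lemma tensor_space_diff:
  assumes "F \<in> tensor_space \<alpha>" "G \<in> tensor_space \<alpha>"
  shows "F - G \<in> tensor_space \<alpha>"
  unfolding tensor_space_iff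
proof (intro conjI allI)
  show "trilinear (F - G)"
    using assms by (blast intro: trilinear_diff tensor_spaceD)
  fix x y z
  show "(F - G) x y z = - eps \<alpha> * (F - G) x z y"
    using assms [THEN tensor_spaceD(2), of x y z] by (simp add: right_diff_distrib)
  show "(F - G) x y z = - eps \<alpha> * (F - G) x (Jop \<alpha> y) (Jop \<alpha> z)"
    using assms [THEN tensor_spaceD(3), of x y z] by (simp add: right_diff_distrib)
qed

lemma zero_tensor_space: "0 \<in> tensor_space \<alpha>"
  unfolding tensor_space_iff by (simp add: trilinearI)

lemma linear_lee_form:
  assumes "F \<in> tensor_space \<alpha>"
  shows "linear (lee_form F)"
proof -
  have "trilinear F"
    using assms by (rule tensor_spaceD)
  then show ?thesis
    by (intro linearI) (simp_all add: lee_form_eq trilinearD [of F] algebra_simps)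
qed

section \<open>Tensors built from a one-form\<close>

text \<open>The right-hand sides of the defining equations of \<open>\<W>\<^sub>4(J\<^sub>1)\<close> and of \<open>\<W>\<^sub>1(J\<^sub>2)\<close>, \<open>\<W>\<^sub>1(J\<^sub>3)\<close>, with
  an arbitrary one-form in place of the Lee form; \<open>eps \<alpha>\<close> accounts for the differing signs.\<close>

definition lee_tensor :: "3 \<Rightarrow> (real^4 \<Rightarrow> real) \<Rightarrow> tensor3" where
  "lee_tensor \<alpha> \<theta> x y z = (if \<alpha> = 1 then 1/2 else 1/4) *
     (neutral_form x y * \<theta> z - eps \<alpha> * neutral_form x (Jop \<alpha> y) * \<theta> (Jop \<alpha> z)
      - eps \<alpha> * neutral_form x z * \<theta> y + neutral_form x (Jop \<alpha> z) * \<theta> (Jop \<alpha> y))"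

lemma HW4_iff: "F \<in> HW4 \<longleftrightarrow> F \<in> tensor_space 1 \<and> F = lee_tensor 1 (lee_form F)"
  by (auto simp: HW4_def lee_tensor_def fun_eq_iff)

lemma NW1_iff:
  assumes "\<alpha> \<noteq> 1"
  shows "F \<in> NW1 \<alpha> \<longleftrightarrow> F \<in> tensor_space \<alpha> \<and> F = lee_tensor \<alpha> (lee_form F)"
  using assms by (auto simp: NW1_def lee_tensor_def fun_eq_iff eps_def)

lemma neutral_form_Jop: "neutral_form (Jop \<alpha> x) y = - eps \<alpha> * neutral_form x (Jop \<alpha> y)"
  using exhaust_3 [of \<alpha>] by (auto simp: neutral_form_def)

lemma lee_tensor_space:
  assumes "linear \<theta>"
  shows "lee_tensor \<alpha> \<theta> \<in> tensor_space \<alpha>"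
proof -
  have "trilinear (lee_tensor \<alpha> \<theta>)"
    by (rule trilinearI)
      (simp_all add: lee_tensor_def linear_add [OF assms] linear_scale [OF assms] Jop_linear_simps
        bilinear_ladd [OF bilinear_neutral_form] bilinear_radd [OF bilinear_neutral_form]
        bilinear_lmul [OF bilinear_neutral_form] bilinear_rmul [OF bilinear_neutral_form]
        algebra_simps)
  moreover have "lee_tensor \<alpha> \<theta> x y z = - eps \<alpha> * lee_tensor \<alpha> \<theta> x z y" for x y z
    using exhaust_3 [of \<alpha>] by (auto simp: lee_tensor_def algebra_simps)
  moreover have "lee_tensor \<alpha> \<theta> x y z = - eps \<alpha> * lee_tensor \<alpha> \<theta> x (Jop \<alpha> y) (Jop \<alpha> z)" for x y z
    using exhaust_3 [of \<alpha>]
    by (auto simp: lee_tensor_def linear_neg [OF assms] bilinear_rneg [OF bilinear_neutral_form]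
        algebra_simps)
  ultimately show ?thesis
    unfolding tensor_space_iff by blast
qed

text \<open>Contracting the four summands gives \<open>4\<theta>\<close>, \<open>0\<close>, \<open>-\<epsilon>\<theta>\<close> and \<open>-\<theta>\<close>, since \<open>J\<close> is trace-free and
  \<open>J\<^sup>2 = -1\<close>. The total is \<open>2\<theta>\<close> or \<open>4\<theta>\<close>, whence the normalizations \<open>1/2\<close> and \<open>1/4\<close>.\<close>

lemma lee_form_lee_tensor:
  assumes "linear \<theta>"
  shows "lee_form (lee_tensor \<alpha> \<theta>) = \<theta>"
proof
  fix z
  show "lee_form (lee_tensor \<alpha> \<theta>) z = \<theta> z"
    using exhaust_3 [of \<alpha>]
    by (auto simp: lee_form_eq lee_tensor_def neutral_form_def bvec_nth
        linear_coordinates [OF assms, of z] linear_coordinates [OF assms, of "Jop _ _"] field_simps)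
qed

section \<open>Hermitian classes in dimension four\<close>

text \<open>Among three distinct basis vectors two are exchanged by \<open>J\<^sub>1\<close> up to sign, so they are \<open>u\<close>, \<open>Ju\<close>, \<open>w\<close>
  up to sign. The symmetries of \<open>F\<close> turn the cyclic sum over them into
  \<open>F(u,u,Jw) + F(Ju,Ju,Jw)\<close>. This is \<open>\<theta>(Jw)\<close> up to sign, because the plane of \<open>w\<close> and \<open>Jw\<close> contributes
  nothing to the trace. The cyclic sum is a 3-form, so these components determine it.\<close>

lemma HW2_iff_lee_form_0:
  assumes F: "F \<in> tensor_space 1"
  shows "F \<in> HW2 \<longleftrightarrow> (\<forall>z. lee_form F z = 0)"
proof -
  have tri: "trilinear F" and skew: "F x y z = - F x z y"
    and JJ: "F x y z = - F x (Jop 1 y) (Jop 1 z)" for x y z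
    using tensor_spaceD(1) [OF F] tensor_spaceD(2) [OF F, of x y z]
      tensor_spaceD(3) [OF F, of x y z] by (simp_all only: eps_simps)
  have Jb: "Jop 1 (bvec 1) = bvec 2" "Jop 1 (bvec 2) = - bvec 1"
    "Jop 1 (bvec 3) = - bvec 4" "Jop 1 (bvec 4) = bvec 3"
    by (simp_all add: vec_eq_iff forall_4 bvec_nth)
  let ?f = "\<lambda>i j k. F (bvec i) (bvec j) (bvec k)"
  have d: "?f i j j = 0" for i j
    using skew [of "bvec i" "bvec j" "bvec j"] by simp
  have c: "?f i 1 2 = 0" "?f i 2 1 = 0" "?f i 3 4 = 0" "?f i 4 3 = 0" 
      "?f i 3 1 = - ?f i 1 3" "?f i 4 1 = - ?f i 1 4" "?f i 2 4 = ?f i 1 3" "?f i 4 2 = - ?f i 1 3"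
      "?f i 2 3 = - ?f i 1 4" "?f i 3 2 = ?f i 1 4" for i
  proof -
    \<comment> \<open>Both symmetries together leave two unknowns for each \<open>i\<close>: the entries \<open>(1,3)\<close> and \<open>(1,4)\<close>.\<close>
    have j: "?f i 1 2 = ?f i 2 1" "?f i 3 4 = ?f i 4 3" "?f i 1 3 = ?f i 2 4" "?f i 1 4 = - ?f i 2 3"
      using JJ [of "bvec i" "bvec 1" "bvec 2"] JJ [of "bvec i" "bvec 3" "bvec 4"]
        JJ [of "bvec i" "bvec 1" "bvec 3"] JJ [of "bvec i" "bvec 1" "bvec 4"]
      by (simp_all only: Jb trilinearD [OF tri] minus_minus)
    note s = skew [of "bvec i" "bvec 1" "bvec 2"] skew [of "bvec i" "bvec 3" "bvec 4"]
      skew [of "bvec i" "bvec 1" "bvec 3"] skew [of "bvec i" "bvec 1" "bvec 4"]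
      skew [of "bvec i" "bvec 2" "bvec 3"] skew [of "bvec i" "bvec 2" "bvec 4"]
    show "?f i 1 2 = 0" "?f i 2 1 = 0" "?f i 3 4 = 0" "?f i 4 3 = 0"
      "?f i 3 1 = - ?f i 1 3" "?f i 4 1 = - ?f i 1 4" "?f i 2 4 = ?f i 1 3" "?f i 4 2 = - ?f i 1 3"
      "?f i 2 3 = - ?f i 1 4" "?f i 3 2 = ?f i 1 4"
      using j s by linarith+
  qed
  have lin: "linear (lee_form F)"
    using F by (rule linear_lee_form)
  let ?S = "\<lambda>x y z. F x y z + F y z x + F z x y"
  have triS: "trilinear ?S"
    by (rule trilinearI) (simp_all add: trilinearD [OF tri] algebra_simps)
  show ?thesis
  proof
    assume "F \<in> HW2"
    then have S: "?S x y z = 0" for x y z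
      by (auto simp: HW2_def)
    have "lee_form F (bvec k) = 0" for k
      using exhaust_4 [of k] S [of "bvec 1" "bvec 2" "bvec 3"] S [of "bvec 1" "bvec 2" "bvec 4"]
        S [of "bvec 1" "bvec 3" "bvec 4"] S [of "bvec 2" "bvec 3" "bvec 4"]
      by (auto simp: lee_form_eq c d)
    then have "lee_form F z = 0" for z
      by (subst linear_coordinates [OF lin]) simp
    then show "\<forall>z. lee_form F z = 0"
      by blast
  next
    assume "\<forall>z. lee_form F z = 0"
    then have L: "lee_form F (bvec k) = 0" for k
      by blast
    have "?f 2 1 4 = ?f 1 1 3" "?f 2 1 3 = - ?f 1 1 4" "?f 4 1 3 = ?f 3 1 4" "?f 4 1 4 = - ?f 3 1 3"
      using L [of 1] L [of 2] L [of 3] L [of 4] by (simp_all add: lee_form_eq c d)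
    then have "?S (bvec i) (bvec j) (bvec k) = 0" for i j k
      using exhaust_4 [of i] exhaust_4 [of j] exhaust_4 [of k]
      by (elim disjE; simp only: c d; simp)
    then have "?S x y z = 0" for x y z
      using trilinear_eq_0 [OF triS] by blast
    with F show "F \<in> HW2"
      by (simp add: HW2_def)
  qed
qed

lemma hermitian_tensor_space_subset: "tensor_space 1 \<subseteq> HW2 + HW4"
proof
  fix F :: tensor3
  assume F: "F \<in> tensor_space 1"
  let ?G = "lee_tensor 1 (lee_form F)"
  note lin = linear_lee_form [OF F]
  have "?G \<in> HW4"
    by (simp add: HW4_iff lee_tensor_space lee_form_lee_tensor lin)
  moreover have "F - ?G \<in> HW2"
    by (subst HW2_iff_lee_form_0)
      (simp_all add: tensor_space_diff F lee_tensor_space lee_form_diff lee_form_lee_tensor lin)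
  ultimately show "F \<in> HW2 + HW4"
    by (metis set_plus_intro diff_add_cancel)
qed

section \<open>Norden classes\<close>

definition twisted_cyclic :: "3 \<Rightarrow> tensor3 \<Rightarrow> tensor3" where
  "twisted_cyclic \<alpha> F x y z = F x y (Jop \<alpha> z) + F y z (Jop \<alpha> x) + F z x (Jop \<alpha> y)"

text \<open>This will be the projection of \<open>F\<close> to \<open>\<W>\<^sub>3\<close>. It is built from the 3-form \<open>T = twisted_cyclic \<alpha> F\<close> in
  the simplest way that is symmetric in \<open>y\<close>, \<open>z\<close>; the factor is fixed by requiring that
  \<open>twisted_cyclic\<close> of it be \<open>T\<close> again.\<close>

definition NW3_part :: "3 \<Rightarrow> tensor3 \<Rightarrow> tensor3" where
  "NW3_part \<alpha> F x y z =
     - 1/4 * (twisted_cyclic \<alpha> F x y (Jop \<alpha> z) + twisted_cyclic \<alpha> F x z (Jop \<alpha> y))"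

lemma NW2_iff:
  "F \<in> NW2 \<alpha> \<longleftrightarrow> F \<in> tensor_space \<alpha> \<and> twisted_cyclic \<alpha> F = 0 \<and> (\<forall>z. lee_form F z = 0)"
  by (auto simp: NW2_def twisted_cyclic_def fun_eq_iff)

lemma twisted_cyclic_add: "twisted_cyclic \<alpha> (F + G) = twisted_cyclic \<alpha> F + twisted_cyclic \<alpha> G"
  by (simp add: twisted_cyclic_def fun_eq_iff)

lemma twisted_cyclic_diff: "twisted_cyclic \<alpha> (F - G) = twisted_cyclic \<alpha> F - twisted_cyclic \<alpha> G"
  by (simp add: twisted_cyclic_def fun_eq_iff)

lemma norden_tensorD:
  assumes "F \<in> tensor_space \<alpha>" "\<alpha> \<noteq> 1"
  shows "trilinear F" "F x z y = F x y z" "F x (Jop \<alpha> y) (Jop \<alpha> z) = F x y z"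
    "F x (Jop \<alpha> y) z = - F x y (Jop \<alpha> z)"
proof -
  have e: "- eps \<alpha> = 1"
    using assms(2) by (simp add: eps_def)
  show tri: "trilinear F" and "F x z y = F x y z"
    and JJ: "F x (Jop \<alpha> y) (Jop \<alpha> z) = F x y z" for y z
    using tensor_spaceD(1) [OF assms(1)] tensor_spaceD(2) [OF assms(1), of x y z]
      tensor_spaceD(3) [OF assms(1), of x y z] by (simp_all only: e mult_1_left)
  show "F x (Jop \<alpha> y) z = - F x y (Jop \<alpha> z)"
    using JJ [of y "Jop \<alpha> z"] by (simp add: trilinearD [OF tri])
qed

text \<open>Tracing the cyclic identity gives \<open>2\<theta>(z) + tr F(z,\<sqdot>,\<sqdot>) = 0\<close>. The remaining trace vanishes
  because \<open>J\<close> is an anti-isometry: it permutes the basis up to sign, preserves \<open>F(z,x,x)\<close> and reverses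
  the sign of \<open>g(x,x)\<close>.\<close>

lemma lee_form_NW3:
  assumes F: "F \<in> NW3 \<alpha>" and "\<alpha> \<noteq> 1"
  shows "lee_form F z = 0"
proof -
  have T: "F \<in> tensor_space \<alpha>" and cyc: "\<And>x y z. F x y z + F y z x + F z x y = 0"
    using F by (auto simp: NW3_def)
  note N = norden_tensorD [OF T \<open>\<alpha> \<noteq> 1\<close>]
  have Jb: "Jop 2 (bvec 1) = bvec 3" "Jop 2 (bvec 2) = bvec 4"
    "Jop 3 (bvec 1) = - bvec 4" "Jop 3 (bvec 2) = bvec 3"
    by (simp_all add: vec_eq_iff forall_4 bvec_nth)
  have "F z (bvec 1) (bvec 1) + F z (bvec 2) (bvec 2) =
      F z (bvec 3) (bvec 3) + F z (bvec 4) (bvec 4)"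
    using exhaust_3 [of \<alpha>] \<open>\<alpha> \<noteq> 1\<close> N(3) [of z "bvec 1" "bvec 1"] N(3) [of z "bvec 2" "bvec 2"]
    by (auto simp: Jb trilinearD [OF N(1)])
  moreover have "2 * F x x z = - F z x x" for x
    using cyc [of x x z] N(2) [of x x z] by simp
  note this [of "bvec 1"] this [of "bvec 2"] this [of "bvec 3"] this [of "bvec 4"]
  ultimately show ?thesis
    by (simp add: lee_form_eq)
qed

text \<open>As \<open>g(x,Jy)\<close> is symmetric for a Norden metric, the twelve terms cancel in pairs.\<close>

lemma twisted_cyclic_lee_tensor:
  assumes "\<alpha> \<noteq> 1" "linear \<theta>"
  shows "twisted_cyclic \<alpha> (lee_tensor \<alpha> \<theta>) = 0"
proof -
  have e: "eps \<alpha> = - 1"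
    using assms by (simp add: eps_def)
  have s: "neutral_form x (Jop \<alpha> y) = neutral_form y (Jop \<alpha> x)" for x y
    using neutral_form_Jop [of \<alpha> x y] by (simp add: e neutral_form_sym)
  have "twisted_cyclic \<alpha> (lee_tensor \<alpha> \<theta>) x y z = 0" for x y z
    using s [of x y] s [of y z] s [of z x] neutral_form_sym [of x y] neutral_form_sym [of y z]
      neutral_form_sym [of z x]
    by (simp add: twisted_cyclic_def lee_tensor_def e assms(1) linear_neg [OF assms(2)]
      bilinear_rneg [OF bilinear_neutral_form] field_simps)
  then show ?thesis
    by (simp add: fun_eq_iff)
qed

lemma NW3_part_in_NW3:
  assumes F: "F \<in> tensor_space \<alpha>" and "\<alpha> \<noteq> 1"
  shows "NW3_part \<alpha> F \<in> NW3 \<alpha>"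
proof -
  note N = norden_tensorD [OF assms]
  have e: "eps \<alpha> = - 1"
    using assms by (simp add: eps_def)
  let ?T = "twisted_cyclic \<alpha> F"
  have T: "trilinear ?T"
    by (rule trilinearI)
      (simp_all add: twisted_cyclic_def trilinearD [OF N(1)] Jop_linear_simps algebra_simps)
  \<comment> \<open>With the evident cyclic symmetry, this makes \<open>T\<close> alternating.\<close>
  have swap: "?T x z y = - ?T x y z" for x y z
    using N(2) [of x z "Jop \<alpha> y"] N(4) [of x y z] N(2) [of z y "Jop \<alpha> x"] N(4) [of z x y]
      N(2) [of y x "Jop \<alpha> z"] N(4) [of y z x]
    by (simp add: twisted_cyclic_def)
  have alt: "?T y x z = - ?T x y z" for x y z
    using swap [of z y x] by (simp add: twisted_cyclic_def)
  have "NW3_part \<alpha> F \<in> tensor_space \<alpha>"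
    unfolding tensor_space_iff
  proof (intro conjI allI)
    show "trilinear (NW3_part \<alpha> F)"
      by (rule trilinearI) (simp_all add: NW3_part_def trilinearD [OF T] Jop_linear_simps algebra_simps)
    fix x y z
    show "NW3_part \<alpha> F x y z = - eps \<alpha> * NW3_part \<alpha> F x z y"
      by (simp add: NW3_part_def e)
    have "?T x (Jop \<alpha> y) z = - ?T x z (Jop \<alpha> y)" "?T x (Jop \<alpha> z) y = - ?T x y (Jop \<alpha> z)"
      by (rule swap)+
    then show "NW3_part \<alpha> F x y z = - eps \<alpha> * NW3_part \<alpha> F x (Jop \<alpha> y) (Jop \<alpha> z)"
      by (simp add: NW3_part_def e trilinearD [OF T])
  qed
  moreover have "NW3_part \<alpha> F x y z + NW3_part \<alpha> F y z x + NW3_part \<alpha> F z x y = 0" for x y z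
    using alt [of x y "Jop \<alpha> z"] alt [of y z "Jop \<alpha> x"] alt [of z x "Jop \<alpha> y"]
    by (simp add: NW3_part_def field_simps)
  ultimately show ?thesis
    by (simp add: NW3_def)
qed

text \<open>In the cyclic sum, \<open>T(x,y,JJz)\<close> contributes \<open>-3T\<close>. The other summand is \<open>T(x,Jz,Jy)\<close>, which
  contributes \<open>-T\<close>: expanding \<open>T(x,Jy,Jz)\<close> gives \<open>F(x,y,Jz) + F(Jy,z,x) - F(Jz,x,y)\<close>, and the last two
  terms cancel in the cyclic sum. The total \<open>-4T\<close> explains the factor \<open>-1/4\<close>.\<close>

lemma twisted_cyclic_NW3_part:
  assumes F: "F \<in> tensor_space \<alpha>" and "\<alpha> \<noteq> 1"
  shows "twisted_cyclic \<alpha> (NW3_part \<alpha> F) = twisted_cyclic \<alpha> F"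
proof -
  note N = norden_tensorD [OF assms]
  have "twisted_cyclic \<alpha> (NW3_part \<alpha> F) x y z = twisted_cyclic \<alpha> F x y z" for x y z
    by (simp add: NW3_part_def twisted_cyclic_def trilinearD [OF N(1)] N(4) N(2)
        Jop_linear_simps field_simps)
  then show ?thesis
    by (simp add: fun_eq_iff)
qed

lemma zero_mem_norden_classes: "0 \<in> NW1 \<alpha>" "0 \<in> NW2 \<alpha>" "0 \<in> NW3 \<alpha>"
  by (simp_all add: NW1_def NW2_def NW3_def zero_tensor_space lee_form_eq)

lemma norden_decomposition:
  assumes F: "F \<in> tensor_space \<alpha>" and "\<alpha> \<noteq> 1"
  obtains G where "G \<in> NW2 \<alpha>" "F = lee_tensor \<alpha> (lee_form F) + G + NW3_part \<alpha> F"
    "lee_tensor \<alpha> (lee_form F) \<in> NW1 \<alpha>"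
proof
  let ?L = "lee_tensor \<alpha> (lee_form F)" and ?P = "NW3_part \<alpha> F"
  note lin = linear_lee_form [OF F]
  have L: "?L \<in> tensor_space \<alpha>"
    by (rule lee_tensor_space [OF lin])
  have P: "?P \<in> NW3 \<alpha>" "?P \<in> tensor_space \<alpha>"
    using NW3_part_in_NW3 [OF assms] by (auto simp: NW3_def)
  show "?L \<in> NW1 \<alpha>"
    using assms(2) by (simp add: NW1_iff L lee_form_lee_tensor lin)
  show "F - ?L - ?P \<in> NW2 \<alpha>"
    unfolding NW2_iff
    by (simp add: tensor_space_diff F L P(2) lee_form_diff lee_form_lee_tensor lin
        lee_form_NW3 [OF P(1) assms(2)] twisted_cyclic_diff
        twisted_cyclic_lee_tensor [OF assms(2) lin] twisted_cyclic_NW3_part [OF assms])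
  show "F = ?L + (F - ?L - ?P) + ?P"
    by simp
qed

lemma norden_mem_sum:
  assumes "F \<in> tensor_space \<alpha>" and "\<alpha> \<noteq> 1"
  shows "F \<in> NW1 \<alpha> + NW2 \<alpha> + NW3 \<alpha>"
  using norden_decomposition [OF assms] NW3_part_in_NW3 [OF assms] by (metis set_plus_intro)

lemma NW1_plus_NW2_iff:
  assumes F: "F \<in> tensor_space \<alpha>" and "\<alpha> \<noteq> 1"
  shows "F \<in> NW1 \<alpha> + NW2 \<alpha> \<longleftrightarrow> twisted_cyclic \<alpha> F = 0"
proof
  assume "F \<in> NW1 \<alpha> + NW2 \<alpha>"
  then obtain G H where "F = G + H" "G \<in> NW1 \<alpha>" "H \<in> NW2 \<alpha>"
    by (rule set_plus_elim)
  moreover from this have "twisted_cyclic \<alpha> G = 0"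
    using assms(2) by (metis NW1_iff twisted_cyclic_lee_tensor linear_lee_form)
  ultimately show "twisted_cyclic \<alpha> F = 0"
    by (simp add: twisted_cyclic_add NW2_iff)
next
  assume "twisted_cyclic \<alpha> F = 0"
  then have "NW3_part \<alpha> F = 0"
    by (simp add: NW3_part_def fun_eq_iff)
  then show "F \<in> NW1 \<alpha> + NW2 \<alpha>"
    using norden_decomposition [OF assms] by (metis set_plus_intro add_0_right)
qed

lemma lee_form_NW2_plus_NW3:
  assumes "F \<in> NW2 \<alpha> + NW3 \<alpha>" and "\<alpha> \<noteq> 1"
  shows "lee_form F z = 0"
  using assms by (auto elim!: set_plus_elim simp: lee_form_add NW2_iff lee_form_NW3)

text \<open>The Lee form does not see the \<open>\<W>\<^sub>3\<close> summand, so subtracting the tensor built from it removes exactly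
  the \<open>\<W>\<^sub>1\<close> summand.\<close>

lemma NW1_plus_NW3_cyclic:
  assumes "F \<in> NW1 \<alpha> + NW3 \<alpha>" and "\<alpha> \<noteq> 1"
  defines "D \<equiv> F - lee_tensor \<alpha> (lee_form F)"
  shows "D x y z + D y z x + D z x y = 0"
proof -
  obtain G H where F: "F = G + H" and G: "G \<in> NW1 \<alpha>" and H: "H \<in> NW3 \<alpha>"
    using assms(1) by (rule set_plus_elim)
  have "lee_form F = lee_form G"
    by (simp add: fun_eq_iff F lee_form_add lee_form_NW3 [OF H assms(2)])
  then have "D = H"
    using G assms(2) by (simp add: D_def F) (metis NW1_iff)
  with H show ?thesis
    by (simp add: NW3_def)
qed

section \<open>Reduction to algebra in a left-invariant frame\<close>

text \<open>\<open>g(\<nabla>\<^sub>x y, z)\<close> for left-invariant fields with bracket \<open>br\<close>: the Koszul formula without the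
  derivatives of the metric coefficients.\<close>

definition koszul :: "(real^4 \<Rightarrow> real^4 \<Rightarrow> real^4) \<Rightarrow> tensor3" where
  "koszul br x y z = 1/2 *
     (neutral_form (br x y) z - neutral_form (br y z) x + neutral_form (br z x) y)"

text \<open>\<open>g((\<nabla>\<^sub>x J)y, z) = g(\<nabla>\<^sub>x Jy, z) - g(J\<nabla>\<^sub>x y, z)\<close>, where \<open>g(Ju, z) = -\<epsilon> g(u, Jz)\<close> moves \<open>J\<close> to the last
  argument.\<close>

definition structure_tensor :: "3 \<Rightarrow> (real^4 \<Rightarrow> real^4 \<Rightarrow> real^4) \<Rightarrow> tensor3" where
  "structure_tensor \<alpha> br x y z = koszul br x (Jop \<alpha> y) z + eps \<alpha> * koszul br x y (Jop \<alpha> z)"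

text \<open>The defining symmetries of the tensor space follow from \<open>J\<^sup>2 = -1\<close> and from the skew symmetry of
  \<open>g(\<nabla>\<^sub>x y, z)\<close> in \<open>y\<close>, \<open>z\<close>.\<close>

lemma structure_tensor_space:
  assumes bil: "bilinear br" and alt: "\<And>x y. br y x = - br x y"
  shows "structure_tensor \<alpha> br \<in> tensor_space \<alpha>"
proof -
  note B = bilinear_ladd [OF bilinear_neutral_form] bilinear_radd [OF bilinear_neutral_form]
    bilinear_lmul [OF bilinear_neutral_form] bilinear_rmul [OF bilinear_neutral_form]
    bilinear_ladd [OF bil] bilinear_radd [OF bil] bilinear_lmul [OF bil] bilinear_rmul [OF bil]
  have K: "trilinear (koszul br)"
    by (rule trilinearI) (simp_all add: koszul_def B algebra_simps)
  have skew: "koszul br x z y = - koszul br x y z" for x y z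
    using alt [of x y] alt [of y z] alt [of z x]
    by (simp add: koszul_def bilinear_lneg [OF bilinear_neutral_form] field_simps)
  show ?thesis
    unfolding tensor_space_iff
  proof (intro conjI allI)
    show "trilinear (structure_tensor \<alpha> br)"
      by (rule trilinearI)
        (simp_all add: structure_tensor_def Jop_linear_simps trilinearD [OF K] algebra_simps)
    fix x y z
    have e: "eps \<alpha> * (eps \<alpha> * t) = t" for t
      by (simp add: eps_mult_self mult.assoc [symmetric])
    show "structure_tensor \<alpha> br x y z = - eps \<alpha> * structure_tensor \<alpha> br x z y"
      using skew [of x "Jop \<alpha> y" z] skew [of x y "Jop \<alpha> z"]
      by (simp add: structure_tensor_def algebra_simps e)
    show "structure_tensor \<alpha> br x y z = - eps \<alpha> * structure_tensor \<alpha> br x (Jop \<alpha> y) (Jop \<alpha> z)"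
      by (simp add: structure_tensor_def algebra_simps e trilinearD [OF K])
  qed
qed

lemma C_diff_const: "C_diff k S (\<lambda>x. c)"
  by (induction k arbitrary: c) simp_all

lemma const_smooth_fun: "(\<lambda>_. c) \<in> smooth_fun A"
  by (auto simp: smooth_fun_def smooth_map_def smooth_on_def comp_def C_diff_const)

lemma vfield_const:
  assumes "X \<in> vfields A"
  shows "X (\<lambda>_. c) = 0"
proof -
  let ?u = "\<lambda>_. 1 :: real"
  have "X (?u * ?u) = X ?u * ?u + ?u * X ?u" and c: "X ((\<lambda>_. c) * ?u) = (\<lambda>_. c) * X ?u"
    using assms const_smooth_fun [of 1 A] unfolding vfields_def by blast+
  then have "X ?u = 0"
    by (simp add: fun_eq_iff times_fun_def)
  with c show ?thesis
    by (simp add: fun_eq_iff times_fun_def)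
qed

lemma comb_4: "comb e x f p = x$1 * e 1 f p + x$2 * e 2 f p + x$3 * e 3 f p + x$4 * e 4 f p"
  for e :: "4 \<Rightarrow> 'm vfield"
  by (simp add: comb_def sum_4 fscale_def)

lemma comb_add: "comb e (x + y) = comb e x + comb e y"
  and comb_scale: "comb e (c *\<^sub>R x) = fscale (\<lambda>_. c) (comb e x)"
  and comb_minus: "comb e (- x) = - comb e x"
  and comb_0: "comb e 0 = 0"
  and comb_bvec: "comb e (bvec i) = e i"
  for e :: "4 \<Rightarrow> 'm vfield"
  using exhaust_4 [of i]
  by (auto simp: fun_eq_iff comb_4 bvec_nth fscale_def algebra_simps)

lemma comb_in_vfields:
  assumes "lie_algebra_basis A e"
  shows "comb e x \<in> vfields A"
  using assms by (auto simp: lie_algebra_basis_def bij_betw_def left_invariant_fields_def)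

text \<open>Bilinearity of the Lie bracket over constants is read off from \<open>[X,Y] = \<nabla>\<^sub>X Y - \<nabla>\<^sub>Y X\<close>; the Leibniz
  rule adds no term because fields annihilate constants.\<close>

lemma lie_bracket_comb:
  fixes e :: "4 \<Rightarrow> 'l::{topological_group_add, t2_space, second_countable_topology} vfield"
  assumes basis: "lie_algebra_basis A e" and "levi_civita A g nabla"
    and bil: "bilinear br"
    and br: "\<And>i j. lie_bracket (e i) (e j) = comb e (br (bvec i) (bvec j))"
  shows "lie_bracket (comb e x) (comb e y) = comb e (br x y)"
proof -
  note V = comb_in_vfields [OF basis]
  have aff: "affine_connection A nabla"
    and tor: "X \<in> vfields A \<Longrightarrow> Y \<in> vfields A \<Longrightarrow> lie_bracket X Y = nabla X Y - nabla Y X" for X Y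
    using assms(2) by (auto simp: levi_civita_def)
  have "lie_bracket (comb e x) (comb e y) f p = comb e (br x y) f p" for f p
  proof -
    let ?L = "\<lambda>x y. lie_bracket (comb e x) (comb e y) f p"
    have add: "nabla (comb e (x + x')) (comb e y) =
        nabla (comb e x) (comb e y) + nabla (comb e x') (comb e y)"
      "nabla (comb e y) (comb e (x + x')) =
        nabla (comb e y) (comb e x) + nabla (comb e y) (comb e x')" for x x' y
      using aff V by (simp_all add: affine_connection_def comb_add)
    have scale: "nabla (comb e (c *\<^sub>R x)) (comb e y) = fscale (\<lambda>_. c) (nabla (comb e x) (comb e y))"
      "nabla (comb e y) (comb e (c *\<^sub>R x)) = fscale (\<lambda>_. c) (nabla (comb e y) (comb e x))" for c x y
      using aff V const_smooth_fun [of c A] vfield_const [OF V, of y c]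
      by (simp_all add: affine_connection_def comb_scale fscale_def fun_eq_iff)
    have "bilinear ?L"
      unfolding bilinear_def
      by (auto intro!: linearI simp: tor V add scale fscale_def algebra_simps)
    moreover have "bilinear (\<lambda>x y. comb e (br x y) f p)"
      unfolding bilinear_def
      by (auto intro!: linearI simp: bilinear_ladd [OF bil] bilinear_radd [OF bil]
          bilinear_lmul [OF bil] bilinear_rmul [OF bil] comb_add comb_scale fscale_def)
    ultimately show ?thesis
      by (rule bilinear_eq_stdbasis [THEN fun_cong, THEN fun_cong])
        (auto simp: Basis_vec_def comb_bvec br)
  qed
  then show ?thesis
    by (simp add: fun_eq_iff)
qed

text \<open>Metric compatibility makes \<open>g(\<nabla>\<^sub>x y, z)\<close> skew in \<open>y\<close>, \<open>z\<close>, as \<open>g(y,z)\<close> is constant; torsion-freeness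
  gives its skew part in \<open>x\<close>, \<open>y\<close>. Applying both alternately through six permutations returns to the
  starting term with the opposite sign.\<close>

lemma levi_civita_koszul:
  fixes e :: "4 \<Rightarrow> 'l::{topological_group_add, t2_space, second_countable_topology} vfield"
  assumes basis: "lie_algebra_basis A e" and lc: "levi_civita A g nabla"
    and metric: "pseudo_riemannian_metric A g"
    and br: "\<And>x y. lie_bracket (comb e x) (comb e y) = comb e (br x y)"
    and g: "\<And>x y. g (comb e x) (comb e y) = (\<lambda>_. neutral_form x y)"
  shows "g (nabla (comb e x) (comb e y)) (comb e z) p = koszul br x y z"
proof -
  note V = comb_in_vfields [OF basis]
  let ?P = "\<lambda>x y z. g (nabla (comb e x) (comb e y)) (comb e z) p"
  have nV: "nabla (comb e x) (comb e y) \<in> vfields A" for x y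
    using lc V by (auto simp: levi_civita_def affine_connection_def)
  have skew: "?P x y z = - ?P x z y" for x y z
  proof -
    have "comb e x (g (comb e y) (comb e z)) = g (nabla (comb e x) (comb e y)) (comb e z) +
        g (comb e y) (nabla (comb e x) (comb e z))"
      using lc V by (auto simp: levi_civita_def)
    moreover have "g (comb e y) (nabla (comb e x) (comb e z)) = g (nabla (comb e x) (comb e z)) (comb e y)"
      using metric V nV by (auto simp: pseudo_riemannian_metric_def)
    ultimately show ?thesis
      by (simp add: g vfield_const [OF V] fun_eq_iff)
        (metis add.commute add_eq_0_iff)
  qed
  have tor: "?P x y z = ?P y x z + neutral_form (br x y) z" for x y z
  proof -
    have "nabla (comb e x) (comb e y) - nabla (comb e y) (comb e x) = comb e (br x y)"
      using lc V br by (simp add: levi_civita_def)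
    then have "nabla (comb e x) (comb e y) = nabla (comb e y) (comb e x) + comb e (br x y)"
      by (simp add: algebra_simps)
    moreover have "g (nabla (comb e y) (comb e x) + comb e (br x y)) (comb e z) =
        g (nabla (comb e y) (comb e x)) (comb e z) + g (comb e (br x y)) (comb e z)"
      using metric V nV by (simp add: pseudo_riemannian_metric_def)
    ultimately show ?thesis
      by (simp add: g)
  qed
  have "2 * koszul br x y z =
      neutral_form (br x y) z - neutral_form (br y z) x + neutral_form (br z x) y"
    by (simp add: koszul_def)
  then show ?thesis
    using tor [of x y z] skew [of y x z] tor [of y z x] skew [of z y x] tor [of z x y] skew [of x z y]
    by linarith
qed

lemma fundamental_tensor_in_frame:
  fixes e :: "4 \<Rightarrow> 'l::{topological_group_add, t2_space, second_countable_topology} vfield"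
  assumes basis: "lie_algebra_basis A e" and lc: "levi_civita A g nabla"
    and HN: "almost_hypercomplex_HN A J g"
    and br: "\<And>x y. lie_bracket (comb e x) (comb e y) = comb e (br x y)"
    and J: "\<And>\<alpha> x. J \<alpha> (comb e x) = comb e (Jop \<alpha> x)"
    and g: "\<And>x y. g (comb e x) (comb e y) = (\<lambda>_. neutral_form x y)"
  shows "tensor_at e (fundamental_tensor g nabla (J \<alpha>)) p = structure_tensor \<alpha> br"
proof (intro ext)
  fix x y z
  note V = comb_in_vfields [OF basis]
  have metric: "pseudo_riemannian_metric A g"
    using HN by (simp add: almost_hypercomplex_HN_def)
  have g_add: "g (X + Y) Z = g X Z + g Y Z"
    if "X \<in> vfields A" "Y \<in> vfields A" "Z \<in> vfields A" for X Y Z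
    using metric that by (simp add: pseudo_riemannian_metric_def)
  have "endomorphism_field A (J \<alpha>)" and JJ: "X \<in> vfields A \<Longrightarrow> J \<alpha> (J \<alpha> X) = - X"
    and compat: "X \<in> vfields A \<Longrightarrow> Y \<in> vfields A \<Longrightarrow> g X Y = (\<lambda>_. eps \<alpha>) * g (J \<alpha> X) (J \<alpha> Y)" for X Y
    using HN unfolding almost_hypercomplex_HN_def by metis+
  then have JV: "J \<alpha> X \<in> vfields A" if "X \<in> vfields A" for X
    using that by (simp add: endomorphism_field_def)
  \<comment> \<open>Since \<open>J\<close> preserves vector fields, so does negation, being \<open>J\<^sup>2\<close>.\<close>
  have neg: "- X \<in> vfields A" if "X \<in> vfields A" for X
    using JV [OF JV [OF that]] JJ [OF that] by simp
  have g_neg: "g (- X) (comb e z) p = - g X (comb e z) p" if "X \<in> vfields A" for X z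
  proof -
    have "g 0 (comb e z) p = 0"
      using g [of 0 z] by (simp add: comb_0 neutral_form_def)
    then have "g X (comb e z) p + g (- X) (comb e z) p = 0"
      using g_add [OF that neg [OF that] V, of z] by (metis plus_fun_apply right_minus)
    then show ?thesis
      by linarith
  qed
  have g_J: "g (J \<alpha> X) (comb e z) p = - eps \<alpha> * g X (comb e (Jop \<alpha> z)) p"
    if "X \<in> vfields A" for X z
  proof -
    have "g (J \<alpha> X) (comb e z) = (\<lambda>_. eps \<alpha>) * g (J \<alpha> (J \<alpha> X)) (J \<alpha> (comb e z))"
      by (rule compat [OF JV [OF that] V])
    then show ?thesis
      by (simp only: JJ [OF that] J times_fun_apply g_neg [OF that])
  qed
  have nV: "nabla (comb e x) (comb e y) \<in> vfields A" for x y
    using lc V by (auto simp: levi_civita_def affine_connection_def)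
  have "g (nabla (comb e x) (comb e (Jop \<alpha> y)) - J \<alpha> (nabla (comb e x) (comb e y))) (comb e z) p =
      g (nabla (comb e x) (comb e (Jop \<alpha> y))) (comb e z) p
      + g (- J \<alpha> (nabla (comb e x) (comb e y))) (comb e z) p"
    using g_add [OF nV neg [OF JV [OF nV]] V, of x "Jop \<alpha> y" x y z]
    by (metis plus_fun_apply diff_conv_add_uminus)
  also have "\<dots> = koszul br x (Jop \<alpha> y) z + eps \<alpha> * koszul br x y (Jop \<alpha> z)"
    by (simp only: g_neg [OF JV [OF nV]] g_J [OF nV] levi_civita_koszul [OF basis lc metric br g])
  finally show "tensor_at e (fundamental_tensor g nabla (J \<alpha>)) p x y z = structure_tensor \<alpha> br x y z"
    by (simp only: tensor_at_def fundamental_tensor_def J structure_tensor_def)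
qed

section \<open>The fundamental tensors of the Lie algebra\<close>

definition g46_bracket :: "real \<Rightarrow> real \<Rightarrow> real^4 \<Rightarrow> real^4 \<Rightarrow> real^4" where
  "g46_bracket a b x y = (x$1 * y$4 - x$4 * y$1) *\<^sub>R (a *\<^sub>R bvec 1)
     + (x$2 * y$4 - x$4 * y$2) *\<^sub>R (b *\<^sub>R bvec 2 - bvec 3)
     + (x$3 * y$4 - x$4 * y$3) *\<^sub>R (bvec 2 + b *\<^sub>R bvec 3)"

lemma g46_bracket_nth:
  "g46_bracket a b x y $ 1 = a * (x$1 * y$4 - x$4 * y$1)"
  "g46_bracket a b x y $ 2 = b * (x$2 * y$4 - x$4 * y$2) + (x$3 * y$4 - x$4 * y$3)"
  "g46_bracket a b x y $ 3 = b * (x$3 * y$4 - x$4 * y$3) - (x$2 * y$4 - x$4 * y$2)"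
  "g46_bracket a b x y $ 4 = 0"
  by (simp_all add: g46_bracket_def bvec_nth)

lemma bilinear_g46_bracket: "bilinear (g46_bracket a b)"
  unfolding bilinear_def
  by (auto intro!: linearI simp: vec_eq_iff forall_4 g46_bracket_nth algebra_simps)

lemma g46_bracket_swap: "g46_bracket a b y x = - g46_bracket a b x y"
  by (simp add: vec_eq_iff forall_4 g46_bracket_nth algebra_simps)

lemma g46_bracket_in_frame:
  fixes e :: "4 \<Rightarrow> 'm vfield"
  assumes "lie_bracket (e 1) (e 4) = comb e (a *\<^sub>R bvec 1)"
    and "lie_bracket (e 2) (e 4) = comb e (b *\<^sub>R bvec 2 - bvec 3)"
    and "lie_bracket (e 3) (e 4) = comb e (bvec 2 + b *\<^sub>R bvec 3)"
    and "lie_bracket (e 1) (e 2) = 0" and "lie_bracket (e 1) (e 3) = 0"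
    and "lie_bracket (e 2) (e 3) = 0"
  shows "lie_bracket (e i) (e j) = comb e (g46_bracket a b (bvec i) (bvec j))"
proof -
  have swap: "lie_bracket Y X = - lie_bracket X Y" for X Y :: "'m vfield"
    by (simp add: lie_bracket_def fun_eq_iff)
  have self: "lie_bracket X X = 0" for X :: "'m vfield"
    by (simp add: lie_bracket_def fun_eq_iff)
  show ?thesis
    using exhaust_4 [of i] exhaust_4 [of j]
    by (elim disjE; simp add: assms self swap [of "e 2" "e 1"] swap [of "e 3" "e 1"]
        swap [of "e 4" "e 1"] swap [of "e 3" "e 2"] swap [of "e 4" "e 2"] swap [of "e 4" "e 3"]
        g46_bracket_def bvec_nth comb_0 flip: comb_minus)
qed

lemma g46_structure_tensor_mem: "structure_tensor \<alpha> (g46_bracket a b) \<in> tensor_space \<alpha>"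
  by (rule structure_tensor_space [OF bilinear_g46_bracket g46_bracket_swap])

lemmas g46_component_simps = structure_tensor_def koszul_def neutral_form_def g46_bracket_nth bvec_nth

text \<open>The values at \<open>e\<^sub>2\<close>, \<open>e\<^sub>3\<close> and \<open>e\<^sub>4\<close>, respectively, are nonzero constants. This excludes \<open>\<W>\<^sub>2(J\<^sub>1)\<close>, \<open>(\<W>\<^sub>2 \<oplus> \<W>\<^sub>3)(J\<^sub>2)\<close> and \<open>\<W>\<^sub>2(J\<^sub>3)\<close>.\<close>

lemma g46_lee_form:
  shows "lee_form (structure_tensor 1 (g46_bracket a b)) z = z$2 + (a + b) * z$3"
    and "lee_form (structure_tensor 2 (g46_bracket a b)) z = (a + 3 * b) * z$2 + z$3"
    and "lee_form (structure_tensor 3 (g46_bracket a b)) z = - 2 * (a + b) * z$1 - 2 * z$4"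
  by (simp_all add: lee_form_eq g46_component_simps algebra_simps)

lemma g46_twisted_cyclic_3: "twisted_cyclic 3 (structure_tensor 3 (g46_bracket a b)) = 0"
  by (simp add: fun_eq_iff twisted_cyclic_def g46_component_simps algebra_simps)

lemma g46_twisted_cyclic_2: "twisted_cyclic 2 (structure_tensor 2 (g46_bracket a b)) \<noteq> 0"
proof
  assume "twisted_cyclic 2 (structure_tensor 2 (g46_bracket a b)) = 0"
  then have "twisted_cyclic 2 (structure_tensor 2 (g46_bracket a b)) (bvec 2) (bvec 3) (bvec 4) = 0"
    by simp
  then show False
    by (simp add: twisted_cyclic_def g46_component_simps)
qed

text \<open>In the three lemmas from here on, the difference between the tensor and the one built from its Lee
  form has the component \<open>1/2\<close> at \<open>(e\<^sub>3,e\<^sub>2,e\<^sub>3)\<close>, the component \<open>-1\<close> at \<open>(e\<^sub>4,e\<^sub>1,e\<^sub>1)\<close>, and the cyclic sum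
  \<open>7/2\<close> over \<open>(e\<^sub>2,e\<^sub>2,e\<^sub>3)\<close>, respectively.\<close>

lemma g46_not_HW4: "structure_tensor 1 (g46_bracket a b) \<notin> HW4"
proof
  let ?F = "structure_tensor 1 (g46_bracket a b)"
  assume "?F \<in> HW4"
  then have "?F = lee_tensor 1 (lee_form ?F)"
    by (simp add: HW4_iff)
  then have "?F (bvec 3) (bvec 2) (bvec 3) = lee_tensor 1 (lee_form ?F) (bvec 3) (bvec 2) (bvec 3)"
    by simp
  then show False
    by (simp add: lee_tensor_def g46_lee_form g46_component_simps)
qed

lemma g46_not_NW1_3: "structure_tensor 3 (g46_bracket a b) \<notin> NW1 3"
proof
  let ?F = "structure_tensor 3 (g46_bracket a b)"
  assume "?F \<in> NW1 3"
  then have "?F = lee_tensor 3 (lee_form ?F)"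
    by (simp add: NW1_iff)
  then have "?F (bvec 4) (bvec 1) (bvec 1) = lee_tensor 3 (lee_form ?F) (bvec 4) (bvec 1) (bvec 1)"
    by simp
  then show False
    by (simp add: lee_tensor_def g46_lee_form g46_component_simps)
qed

lemma g46_not_NW1_NW3: "structure_tensor 2 (g46_bracket a b) \<notin> NW1 2 + NW3 2"
proof
  assume "structure_tensor 2 (g46_bracket a b) \<in> NW1 2 + NW3 2"
  from NW1_plus_NW3_cyclic [OF this, of "bvec 2" "bvec 2" "bvec 3"] show False
    by (simp add: lee_tensor_def g46_lee_form g46_component_simps)
qed

theorem theorem4p1:
  fixes a b :: real
    and A :: "('l::{topological_group_add, t2_space, second_countable_topology}, real^4) atlas"
    and e :: "4 \<Rightarrow> 'l vfield"
    and J :: "3 \<Rightarrow> 'l vfield \<Rightarrow> 'l vfield"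
    and g :: "'l vfield \<Rightarrow> 'l vfield \<Rightarrow> 'l \<Rightarrow> real"
    and nabla :: "'l vfield \<Rightarrow> 'l vfield \<Rightarrow> 'l vfield"
    and F :: "3 \<Rightarrow> 'l \<Rightarrow> tensor3"
  assumes "a \<noteq> 0" and "b \<ge> 0"
    and "lie_group A" and "simply_connected (UNIV :: 'l set)"
    and "lie_algebra_basis A e"
    and "lie_bracket (e 1) (e 4) = comb e (a *\<^sub>R bvec 1)"
    and "lie_bracket (e 2) (e 4) = comb e (b *\<^sub>R bvec 2 - bvec 3)"
    and "lie_bracket (e 3) (e 4) = comb e (bvec 2 + b *\<^sub>R bvec 3)"
    and "lie_bracket (e 1) (e 2) = 0" and "lie_bracket (e 1) (e 3) = 0"
    and "lie_bracket (e 2) (e 3) = 0"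
    and "almost_hypercomplex_HN A J g"
    and "\<And>\<alpha> x. J \<alpha> (comb e x) = comb e (Jop \<alpha> x)"
    and "\<And>x y. g (comb e x) (comb e y) = (\<lambda>_. neutral_form x y)"
    and "levi_civita A g nabla"
  defines "F \<equiv> \<lambda>\<alpha>. tensor_at e (fundamental_tensor g nabla (J \<alpha>))"
  shows "belongs (F 1) (HW2 + HW4) \<and> belongs (F 2) (NW1 2 + NW2 2 + NW3 2) \<and>
      belongs (F 3) (NW1 3 + NW2 3) \<and>
      \<not> belongs (F 1) HW2 \<and> \<not> belongs (F 1) HW4 \<and>
      \<not> belongs (F 2) (NW1 2) \<and> \<not> belongs (F 2) (NW2 2) \<and> \<not> belongs (F 2) (NW3 2) \<and>
      \<not> belongs (F 2) (NW1 2 + NW2 2) \<and> \<not> belongs (F 2) (NW1 2 + NW3 2) \<and>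
      \<not> belongs (F 2) (NW2 2 + NW3 2) \<and>
      \<not> belongs (F 3) (NW1 3) \<and> \<not> belongs (F 3) (NW2 3)"
proof -
  let ?F = "\<lambda>\<alpha>. structure_tensor \<alpha> (g46_bracket a b)"
  have "lie_bracket (comb e x) (comb e y) = comb e (g46_bracket a b x y)" for x y
    by (rule lie_bracket_comb [OF assms(5) assms(15) bilinear_g46_bracket
          g46_bracket_in_frame [OF assms(6-11)]])
  then have F: "F \<alpha> p = ?F \<alpha>" for \<alpha> p
    unfolding F_def
    by (rule fundamental_tensor_in_frame [OF assms(5) assms(15) assms(12) _ assms(13,14)])
  have belongs: "belongs (F \<alpha>) W \<longleftrightarrow> ?F \<alpha> \<in> W" for \<alpha> W
    by (simp add: belongs_def F)
  note mem = g46_structure_tensor_mem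
  have "?F 1 \<in> HW2 + HW4"
    using hermitian_tensor_space_subset mem by blast
  moreover have "?F 2 \<in> NW1 2 + NW2 2 + NW3 2"
    by (rule norden_mem_sum [OF mem]) simp
  moreover have "?F 3 \<in> NW1 3 + NW2 3"
    by (simp add: NW1_plus_NW2_iff mem g46_twisted_cyclic_3)
  moreover have "?F 1 \<notin> HW2"
  proof
    assume "?F 1 \<in> HW2"
    then have "lee_form (?F 1) (bvec 2) = 0"
      by (simp add: HW2_iff_lee_form_0 mem)
    then show False
      by (simp add: g46_lee_form bvec_nth)
  qed
  moreover have not_12: "?F 2 \<notin> NW1 2 + NW2 2"
    by (simp add: NW1_plus_NW2_iff mem g46_twisted_cyclic_2)
  moreover have not_23: "?F 2 \<notin> NW2 2 + NW3 2"
  proof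
    assume "?F 2 \<in> NW2 2 + NW3 2"
    then have "lee_form (?F 2) (bvec 3) = 0"
      by (rule lee_form_NW2_plus_NW3) simp
    then show False
      by (simp add: g46_lee_form bvec_nth)
  qed
  \<comment> \<open>Each summand contains 0, so it lies in the sums excluded above.\<close>
  moreover have "?F 2 \<notin> NW1 2" "?F 2 \<notin> NW2 2" "?F 2 \<notin> NW3 2"
    using not_12 not_23 zero_mem_norden_classes [of 2]
    by (metis add_0_right add_0_left set_plus_intro)+
  moreover have "?F 3 \<notin> NW2 3"
  proof
    assume "?F 3 \<in> NW2 3"
    then have "lee_form (?F 3) (bvec 4) = 0"
      by (simp add: NW2_iff)
    then show False
      by (simp add: g46_lee_form bvec_nth)
  qed
  ultimately show ?thesis
    by (simp add: belongs g46_not_HW4 g46_not_NW1_NW3 g46_not_NW1_3)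
qed

end
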